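(* Let $L$ be a primitive Gaussian line, with associated Gaussian integers $\alpha_0$ and $\delta$ and with Gaussian integers $\alpha_n=\alpha_0+\delta n$, $n\in\mathbb{Z}$. Suppose $\beta\in\mathbb{Z}[i]$ divides some Gaussian integer $\alpha_t$ on $L$. Then, for $n\in\mathbb{Z}$, $\beta$ divides $\alpha_n$ if and only if $n\equiv t\pmod{\nu(\beta)}$.
   Context: A Gaussian line is a line in the complex plane containing at least two (hence infinitely many) elements of $\mathbb{Z}[i]$. It is primitive if the Gaussian integers on it do not all share a common non-unit divisor in $\mathbb{Z}[i]$. For a Gaussian line $L$, $\alpha_0=a+bi$ denotes the Gaussian integer on $L$ of minimum norm $N(x+iy)=x^2+y^2$ (if there are two, the one with larger real part). If $L$ is vertical, $\delta=i$; otherwise $\delta=c+di=\alpha_1-\alpha_0$, where $\alpha_1$ is the Gaussian integer on $L$ closest to $\alpha_0$ with $\mathrm{Re}(\alpha_1)>\mathrm{Re}(\alpha_0)$. Then the Gaussian integers on $L$ are exactly $\alpha_n=\alpha_0+\delta n$, $n\in\mathbb{Z}$. The function $\nu:\mathbb{Z}[i]\to\mathbb{Z}$ is defined by $\nu(x+iy)=\frac{x^2+y^2}{\gcd(x,y)}$ for $x+iy\neq 0$, and $\nu(0)=0$. Divisibility is in $\mathbb{Z}[i]$. *)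

theory Defs
  imports "HOL-Analysis.Analysis" "HOL-Number_Theory.Cong"
begin

definition gaussian_ints :: "complex set" where
  "gaussian_ints = {z. Re z \<in> \<int> \<and> Im z \<in> \<int>}"

text \<open>Divisibility must be relative to the ring of Gaussian integers: \<^const>\<open>dvd\<close> on
  \<^typ>\<open>complex\<close> is divisibility in a field.\<close>

definition gauss_dvd :: "complex \<Rightarrow> complex \<Rightarrow> bool" (infix "gdvd" 50) where
  "a gdvd b \<longleftrightarrow> a \<in> gaussian_ints \<and> b \<in> gaussian_ints \<and> (\<exists>c\<in>gaussian_ints. b = a * c)"

definition gauss_unit :: "complex \<Rightarrow> bool" where
  "gauss_unit u \<longleftrightarrow> u gdvd 1"

definition gauss_norm :: "complex \<Rightarrow> real" where
  "gauss_norm z = (Re z)\<^sup>2 + (Im z)\<^sup>2"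

text \<open>On a Gaussian integer the two floors are exact, and the division by the gcd leaves no
  remainder.\<close>

definition nu :: "complex \<Rightarrow> int" where
  "nu z = (let x = \<lfloor>Re z\<rfloor>; y = \<lfloor>Im z\<rfloor> in
     if z = 0 then 0 else (x\<^sup>2 + y\<^sup>2) div gcd x y)"

definition gaussian_line :: "complex set \<Rightarrow> bool" where
  "gaussian_line L \<longleftrightarrow> affine L \<and> aff_dim L = 1 \<and>
     (\<exists>z\<in>L \<inter> gaussian_ints. \<exists>w\<in>L \<inter> gaussian_ints. z \<noteq> w)"

definition primitive_line :: "complex set \<Rightarrow> bool" where
  "primitive_line L \<longleftrightarrow> gaussian_line L \<and>
     \<not> (\<exists>d\<in>gaussian_ints. \<not> gauss_unit d \<and> (\<forall>z\<in>L \<inter> gaussian_ints. d gdvd z))"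

definition vertical :: "complex set \<Rightarrow> bool" where
  "vertical L \<longleftrightarrow> (\<forall>z\<in>L. \<forall>w\<in>L. Re z = Re w)"

text \<open>For a Gaussian line \<open>L\<close> the point described by \<open>alpha0\<close> exists and is unique: at most two
  points of a line have the same norm, and on a vertical Gaussian line the point of minimum norm is
  the one on the real axis. The point described by \<open>alpha1\<close> exists and is unique if \<open>L\<close> is a
  non-vertical Gaussian line; it is not used otherwise.\<close>

definition alpha0 :: "complex set \<Rightarrow> complex" where
  "alpha0 L = (THE z. z \<in> L \<inter> gaussian_ints \<and>
     (\<forall>w\<in>L \<inter> gaussian_ints. gauss_norm z \<le> gauss_norm w) \<and>
     (\<forall>w\<in>L \<inter> gaussian_ints. gauss_norm w = gauss_norm z \<longrightarrow> Re w \<le> Re z))"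

definition alpha1 :: "complex set \<Rightarrow> complex" where
  "alpha1 L = (THE z. z \<in> L \<inter> gaussian_ints \<and> Re (alpha0 L) < Re z \<and>
     (\<forall>w\<in>L \<inter> gaussian_ints. Re (alpha0 L) < Re w \<longrightarrow> dist (alpha0 L) z \<le> dist (alpha0 L) w))"

definition delta :: "complex set \<Rightarrow> complex" where
  "delta L = (if vertical L then \<i> else alpha1 L - alpha0 L)"

definition alpha :: "complex set \<Rightarrow> int \<Rightarrow> complex" where
  "alpha L n = alpha0 L + delta L * of_int n"

end

theory Submission
  imports Defs
begin

text \<open>A common divisor of \<open>\<beta>\<close> and \<open>\<delta>\<close> divides \<open>\<alpha>\<^sub>t\<close> and hence every Gaussian integer
  on the line, so primitivity makes \<open>\<beta>\<close> and \<open>\<delta>\<close> coprime. Since \<open>\<alpha>\<^sub>n - \<alpha>\<^sub>t = \<delta>(n - t)\<close>,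
  \<open>\<beta>\<close> divides \<open>\<alpha>\<^sub>n\<close> iff it divides the rational integer \<open>n - t\<close>; multiplying by the conjugate
  of \<open>\<beta>\<close> shows that this means \<open>\<nu>(\<beta>)\<close> divides \<open>n - t\<close>.\<close>

section \<open>Gaussian integers: closure properties and divisibility\<close>

lemma gaussian_intsE:
  assumes "z \<in> gaussian_ints"
  obtains x y :: int where "z = Complex (of_int x) (of_int y)"
  using assms by (auto simp: gaussian_ints_def complex_eq_iff elim!: Ints_cases)

lemma Complex_of_int_in_gaussian_ints [simp]: "Complex (of_int x) (of_int y) \<in> gaussian_ints"
  by (simp add: gaussian_ints_def)

lemma gaussian_ints_of_int [simp]: "of_int k \<in> gaussian_ints"
  by (simp add: gaussian_ints_def)

lemma gaussian_ints_0 [simp]: "0 \<in> gaussian_ints"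
  by (simp add: gaussian_ints_def)

lemma gaussian_ints_1 [simp]: "1 \<in> gaussian_ints"
  by (simp add: gaussian_ints_def)

lemma gaussian_ints_i [simp]: "\<i> \<in> gaussian_ints"
  by (simp add: gaussian_ints_def)

lemma gaussian_ints_add [simp, intro]:
  "a \<in> gaussian_ints \<Longrightarrow> b \<in> gaussian_ints \<Longrightarrow> a + b \<in> gaussian_ints"
  by (simp add: gaussian_ints_def)

lemma gaussian_ints_diff [simp, intro]:
  "a \<in> gaussian_ints \<Longrightarrow> b \<in> gaussian_ints \<Longrightarrow> a - b \<in> gaussian_ints"
  by (simp add: gaussian_ints_def)

lemma gaussian_ints_mult [simp, intro]:
  "a \<in> gaussian_ints \<Longrightarrow> b \<in> gaussian_ints \<Longrightarrow> a * b \<in> gaussian_ints"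
  by (simp add: gaussian_ints_def)

lemma gdvd_add: "a gdvd b \<Longrightarrow> a gdvd c \<Longrightarrow> a gdvd (b + c)"
  unfolding gauss_dvd_def by (metis distrib_left gaussian_ints_add)

lemma gdvd_diff: "a gdvd b \<Longrightarrow> a gdvd c \<Longrightarrow> a gdvd (b - c)"
  unfolding gauss_dvd_def by (metis right_diff_distrib gaussian_ints_diff)

lemma gdvd_mult: "a gdvd b \<Longrightarrow> c \<in> gaussian_ints \<Longrightarrow> a gdvd (b * c)"
  unfolding gauss_dvd_def by (metis mult.assoc gaussian_ints_mult)

lemma gdvd_trans: "a gdvd b \<Longrightarrow> b gdvd c \<Longrightarrow> a gdvd c"
  unfolding gauss_dvd_def by (metis mult.assoc gaussian_ints_mult)

section \<open>The norm, division with remainder and Bezout's identity\<close>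

lemma gauss_norm_mult: "gauss_norm (a * b) = gauss_norm a * gauss_norm b"
  by (simp add: gauss_norm_def power2_eq_square algebra_simps)

lemma gauss_norm_eq_norm: "gauss_norm z = (norm z)\<^sup>2"
  by (simp add: gauss_norm_def cmod_power2)

lemma gauss_norm_less_iff: "gauss_norm a < gauss_norm b \<longleftrightarrow> norm a < norm b"
  unfolding gauss_norm_eq_norm by (metis norm_ge_zero abs_norm_cancel power2_less_eq_zero_iff
    power_mono_iff zero_less_numeral linorder_not_le)

lemma gauss_norm_nat:
  assumes "z \<in> gaussian_ints"
  shows "gauss_norm z = real (nat \<lfloor>gauss_norm z\<rfloor>)"
proof -
  obtain x y where z: "z = Complex (of_int x) (of_int y)"
    using assms by (rule gaussian_intsE)
  have "gauss_norm z = of_int (x\<^sup>2 + y\<^sup>2)" by (simp add: z gauss_norm_def)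
  then show ?thesis by (metis floor_of_int of_nat_nat sum_power2_ge_zero of_int_of_nat_eq)
qed

text \<open>Norms of Gaussian integers are natural numbers, hence well-ordered. The map
  \<open>f\<close> lets the result serve for least norm as well as for least distance from a fixed
  point.\<close>

lemma exists_min_gauss_norm:
  assumes "x \<in> S" and "f ` S \<subseteq> gaussian_ints"
  obtains z where "z \<in> S" and "\<And>w. w \<in> S \<Longrightarrow> gauss_norm (f z) \<le> gauss_norm (f w)"
proof -
  obtain z where z: "z \<in> S"
    "\<And>w. w \<in> S \<Longrightarrow> nat \<lfloor>gauss_norm (f z)\<rfloor> \<le> nat \<lfloor>gauss_norm (f w)\<rfloor>"
    using ex_has_least_nat[of "\<lambda>w. w \<in> S" x "\<lambda>w. nat \<lfloor>gauss_norm (f w)\<rfloor>"] assms(1) by auto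
  have "gauss_norm (f z) \<le> gauss_norm (f w)" if w: "w \<in> S" for w
  proof -
    have "f z \<in> gaussian_ints" "f w \<in> gaussian_ints" using assms(2) z(1) w by auto
    then show ?thesis
      using z(2)[OF w] gauss_norm_nat by (metis of_nat_le_iff)
  qed
  then show thesis using that z(1) by blast
qed

text \<open>Rounding both coordinates of the exact quotient leaves an error of norm at most 1/4 +
  1/4, and the norm is multiplicative.\<close>

lemma gaussian_division:
  assumes "b \<noteq> 0"
  obtains q where "q \<in> gaussian_ints" and "gauss_norm (a - b * q) < gauss_norm b"
proof -
  define u where "u = a / b"
  define q where "q = Complex (of_int (round (Re u))) (of_int (round (Im u)))"
  have "\<bar>Re (u - q)\<bar> \<le> 1/2" "\<bar>Im (u - q)\<bar> \<le> 1/2"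
    using of_int_round_abs_le[of "Re u"] of_int_round_abs_le[of "Im u"]
    by (simp_all add: q_def abs_minus_commute)
  then have "(Re (u - q))\<^sup>2 \<le> (1/2)\<^sup>2" "(Im (u - q))\<^sup>2 \<le> (1/2)\<^sup>2"
    by (metis abs_le_square_iff abs_of_nonneg zero_le_divide_1_iff zero_le_numeral)+
  then have "gauss_norm (u - q) < 1"
    by (simp add: gauss_norm_def power2_eq_square)
  moreover have "a - b * q = b * (u - q)"
    using assms by (simp add: u_def right_diff_distrib)
  moreover have "gauss_norm b > 0"
    using assms by (simp add: gauss_norm_eq_norm)
  ultimately have "gauss_norm (a - b * q) < gauss_norm b"
    by (simp add: gauss_norm_mult)
  then show thesis using that[of q] by (simp add: q_def)
qed

text \<open>A nonzero element of minimal norm in the ideal generated by \<open>a\<close> and \<open>b\<close> divides both.\<close>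

lemma gaussian_bezout:
  assumes a: "a \<in> gaussian_ints" and b: "b \<in> gaussian_ints" "b \<noteq> 0"
    and cop: "\<And>d. d gdvd a \<Longrightarrow> d gdvd b \<Longrightarrow> gauss_unit d"
  obtains x y where "x \<in> gaussian_ints" "y \<in> gaussian_ints" "a * x + b * y = 1"
proof -
  define I where "I = {a * x + b * y | x y. x \<in> gaussian_ints \<and> y \<in> gaussian_ints}"
  have I_G: "I \<subseteq> gaussian_ints" using a b by (auto simp: I_def)
  have aI: "a \<in> I" unfolding I_def by (rule CollectI, rule exI[of _ 1], rule exI[of _ 0]) simp
  have bI: "b \<in> I" unfolding I_def by (rule CollectI, rule exI[of _ 0], rule exI[of _ 1]) simp
  \<comment> \<open>The remainder of one element of the ideal on division by another stays in the
    ideal.\<close>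
  have I_diff: "u - v * q \<in> I" if uv: "u \<in> I" "v \<in> I" and q: "q \<in> gaussian_ints" for u v q
  proof -
    obtain x y x' y' where
      "x \<in> gaussian_ints" "y \<in> gaussian_ints" "x' \<in> gaussian_ints" "y' \<in> gaussian_ints"
      and u: "u = a * x + b * y" and v: "v = a * x' + b * y'"
      using uv by (auto simp: I_def)
    moreover have "u - v * q = a * (x - x' * q) + b * (y - y' * q)"
      by (simp add: u v algebra_simps)
    ultimately show ?thesis using q unfolding I_def by blast
  qed
  obtain g where g: "g \<in> I - {0}" and
    min: "\<And>w. w \<in> I - {0} \<Longrightarrow> gauss_norm g \<le> gauss_norm w"
    using exists_min_gauss_norm[of b "I - {0}" "\<lambda>w. w"] bI b(2) I_G by auto
  have dvd: "g gdvd u" if u: "u \<in> I" for u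
  proof -
    obtain q where q: "q \<in> gaussian_ints" "gauss_norm (u - g * q) < gauss_norm g"
      using gaussian_division[of g u] g by auto
    have "u - g * q \<in> I" using I_diff u g q by blast
    \<comment> \<open>The remainder has smaller norm than \<open>g\<close>, so minimality forces it
      to be 0.\<close>
    then have "u = g * q" using min[of "u - g * q"] q by auto
    then show ?thesis using q u g I_G by (auto simp: gauss_dvd_def)
  qed
  have "g gdvd 1" using cop dvd aI bI by (auto simp: gauss_unit_def)
  then obtain h where h: "h \<in> gaussian_ints" "1 = g * h" by (auto simp: gauss_dvd_def)
  obtain x y where "x \<in> gaussian_ints" "y \<in> gaussian_ints" "g = a * x + b * y"
    using g by (auto simp: I_def)
  \<comment> \<open>\<open>h\<close> inverts \<open>g\<close>, so scaling the representation of
    \<open>g\<close> by \<open>h\<close> represents 1.\<close>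
  then show thesis
    using h by (intro that[of "x * h" "y * h"]) (auto simp: algebra_simps)
qed

section \<open>Rational integers divisible by a Gaussian integer\<close>

text \<open>For nonzero \<open>\<beta>\<close> with coordinates \<open>x\<close> and
  \<open>y\<close>, the quotient of \<open>m\<close> by \<open>\<beta>\<close> is \<open>m\<close>
  times the conjugate of \<open>\<beta>\<close>, divided by the norm. It is Gaussian exactly when
  the norm divides both \<open>m * x\<close> and \<open>m * y\<close>, that is, divides
  \<open>m * gcd x y\<close>; cancelling the gcd leaves \<open>nu \<beta>\<close>.\<close>

lemma gdvd_of_int_iff:
  assumes "\<beta> \<in> gaussian_ints"
  shows "\<beta> gdvd of_int m \<longleftrightarrow> nu \<beta> dvd m"
proof (cases "\<beta> = 0")
  case True
  \<comment> \<open>Only 0 is a multiple of 0, which matches the convention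
    \<open>nu 0 = 0\<close>.\<close>
  then show ?thesis using gaussian_ints_0 by (auto simp: gauss_dvd_def nu_def simp del: gaussian_ints_0)
next
  case False
  obtain x y where \<beta>: "\<beta> = Complex (of_int x) (of_int y)"
    using assms by (rule gaussian_intsE)
  define g where "g = gcd x y"
  have g0: "g \<noteq> 0" using False by (auto simp: \<beta> g_def complex_eq_iff)
  obtain x' y' where x': "x = g * x'" and y': "y = g * y'"
    using g_def by (metis gcd_dvd1 gcd_dvd2 dvdE)
  have nu: "nu \<beta> = g * (x'\<^sup>2 + y'\<^sup>2)"
  proof -
    have "nu \<beta> = (x\<^sup>2 + y\<^sup>2) div g" using False by (simp add: nu_def \<beta> Let_def g_def)
    also have "x\<^sup>2 + y\<^sup>2 = g * (g * (x'\<^sup>2 + y'\<^sup>2))"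
      unfolding x' y' by (simp add: power2_eq_square algebra_simps)
    finally show ?thesis using g0 by simp
  qed
  have N: "x\<^sup>2 + y\<^sup>2 = nu \<beta> * g"
    unfolding nu x' y' by (simp add: power2_eq_square algebra_simps)
  show ?thesis
  proof
    assume "nu \<beta> dvd m"
    then obtain k where k: "m = g * (x'\<^sup>2 + y'\<^sup>2) * k" unfolding nu by blast
    \<comment> \<open>The cofactor is \<open>k\<close> times the conjugate of
      \<open>\<beta> / g\<close>; the product of \<open>\<beta>\<close> with that conjugate is
      \<open>nu \<beta>\<close>.\<close>
    have "of_int m = \<beta> * Complex (of_int (k * x')) (of_int (- k * y'))"
      unfolding k \<beta> x' y'
      by (simp add: complex_eq_iff power2_eq_square algebra_simps)
    then show "\<beta> gdvd of_int m"
      unfolding gauss_dvd_def using assms Complex_of_int_in_gaussian_ints gaussian_ints_of_int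
      by blast
  next
    assume "\<beta> gdvd of_int m"
    then obtain c where "c \<in> gaussian_ints" and c: "of_int m = \<beta> * c"
      by (auto simp: gauss_dvd_def)
    then obtain p q where pq: "c = Complex (of_int p) (of_int q)"
      by (blast elim: gaussian_intsE)
    have "real_of_int m = of_int (x * p - y * q)" "real_of_int 0 = of_int (x * q + y * p)"
      using c by (simp_all add: pq \<beta> complex_eq_iff)
    then have m: "m = x * p - y * q" and z: "x * q + y * p = 0" by linarith+
    \<comment> \<open>Up to sign, this and the next equation are the coordinates of
      \<open>m = \<beta> * c\<close> multiplied by the conjugate of \<open>\<beta>\<close>. The
      terms containing \<open>x * q + y * p\<close> vanish by \<open>z\<close>.\<close>
    have "m * x = (x\<^sup>2 + y\<^sup>2) * p - y * (x * q + y * p)"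
      unfolding m by (simp add: power2_eq_square algebra_simps)
    moreover have "m * y = x * (x * q + y * p) - (x\<^sup>2 + y\<^sup>2) * q"
      unfolding m by (simp add: power2_eq_square algebra_simps)
    ultimately have "x\<^sup>2 + y\<^sup>2 dvd m * x" "x\<^sup>2 + y\<^sup>2 dvd m * y" using z by simp_all
    then have "x\<^sup>2 + y\<^sup>2 dvd gcd (m * x) (m * y)" by simp
    also have "gcd (m * x) (m * y) = \<bar>m\<bar> * g"
      by (simp add: gcd_mult_left g_def abs_mult)
    finally have "nu \<beta> * g dvd \<bar>m\<bar> * g" by (simp add: N)
    then show "nu \<beta> dvd m" using g0 by simp
  qed
qed

section \<open>Lines and the enumeration of their Gaussian integers\<close>

text \<open>The affine hull of two distinct points of \<open>L\<close> is contained in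
  \<open>L\<close> and has the same dimension 1; a proper affine subset would have smaller
  dimension.\<close>

lemma gaussian_line_eq:
  assumes "gaussian_line L" "z \<in> L" "w \<in> L" "z \<noteq> w"
  shows "L = range (\<lambda>r. z + of_real r * (w - z))"
proof -
  have "affine hull {z, w} \<subseteq> L"
    using assms by (intro hull_minimal) (auto simp: gaussian_line_def)
  moreover have "aff_dim (affine hull {z, w}) = aff_dim L"
    using assms by (simp add: gaussian_line_def aff_dim_2)
  ultimately have "affine hull {z, w} = L"
    using assms aff_dim_psubset by (metis gaussian_line_def affine_hull_eq affine_affine_hull
      psubsetI order_less_irrefl)
  then show ?thesis by (auto simp: affine_hull_2_alt scaleR_conv_of_real)
qed

text \<open>A definite description is only usable after existence and uniqueness are shown.
  Existence: minimise the norm, then maximise the real part among the minimisers. Uniqueness: two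
  candidates would be complex conjugates, and their midpoint would beat both.\<close>

lemma alpha0_properties:
  assumes L: "gaussian_line L"
  shows "alpha0 L \<in> L \<inter> gaussian_ints"
proof -
  let ?S = "L \<inter> gaussian_ints"
  let ?P = "\<lambda>z. z \<in> ?S \<and> (\<forall>w\<in>?S. gauss_norm z \<le> gauss_norm w) \<and>
     (\<forall>w\<in>?S. gauss_norm w = gauss_norm z \<longrightarrow> Re w \<le> Re z)"
  obtain z0 where z0: "z0 \<in> ?S" "\<And>w. w \<in> ?S \<Longrightarrow> gauss_norm z0 \<le> gauss_norm w"
    using L exists_min_gauss_norm[of _ ?S "\<lambda>w. w"] unfolding gaussian_line_def
    by (metis image_ident inf_le2)
  define M where "M = gauss_norm z0"
  define T where "T = {w \<in> ?S. gauss_norm w = M}"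
  have Re_int: "Re w = of_int \<lfloor>Re w\<rfloor>" if "w \<in> ?S" for w
    using that by (auto simp: gaussian_ints_def elim!: Ints_cases)
  \<comment> \<open>An integer is at most its square, so real parts of minimisers are bounded by the
    minimal norm. Hence \<open>nat\<close> truncates nothing when the largest real part is found
    below by minimising its distance to that bound.\<close>
  have bd: "\<lfloor>Re w\<rfloor> \<le> \<lfloor>M\<rfloor>" if w: "w \<in> T" for w
  proof -
    have "real_of_int \<lfloor>Re w\<rfloor> \<le> of_int (\<lfloor>Re w\<rfloor>\<^sup>2)"
      by (subst of_int_le_iff) (smt (verit) power2_eq_square mult_le_cancel_left1 zero_le_power2)
    also have "\<dots> = (Re w)\<^sup>2" using w Re_int[of w] by (simp add: T_def)
    also have "\<dots> \<le> M" using w by (auto simp: T_def gauss_norm_def)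
    finally show ?thesis by (simp add: le_floor_iff)
  qed
  obtain z where z: "z \<in> T" "\<And>w. w \<in> T \<Longrightarrow> nat (\<lfloor>M\<rfloor> - \<lfloor>Re z\<rfloor>) \<le> nat (\<lfloor>M\<rfloor> - \<lfloor>Re w\<rfloor>)"
    using ex_has_least_nat[of "\<lambda>w. w \<in> T" z0 "\<lambda>w. nat (\<lfloor>M\<rfloor> - \<lfloor>Re w\<rfloor>)"] z0
    by (auto simp: T_def M_def)
  have Pz: "?P z"
  proof (intro conjI ballI impI)
    show "z \<in> ?S" using z(1) by (simp add: T_def)
    show "gauss_norm z \<le> gauss_norm w" if "w \<in> ?S" for w
      using z(1) z0(2)[OF that] by (simp add: T_def M_def)
    show "Re w \<le> Re z" if w: "w \<in> ?S" "gauss_norm w = gauss_norm z" for w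
    proof -
      have wT: "w \<in> T" using w z(1) by (simp add: T_def)
      then have "\<lfloor>Re w\<rfloor> \<le> \<lfloor>Re z\<rfloor>" using z(2)[OF wT] bd[OF wT] bd[OF z(1)] by linarith
      then show ?thesis using Re_int[of w] Re_int[of z] w z(1) unfolding T_def by auto
    qed
  qed
  have "\<exists>!z. ?P z"
  proof (rule ex1I[of _ z])
    fix w assume Pw: "?P w"
    have nrm: "gauss_norm w = gauss_norm z" using Pw Pz by (metis order_antisym)
    then have Re: "Re w = Re z" using Pw Pz by (metis order_antisym)
    show "w = z"
    proof (rule ccontr)
      assume ne: "w \<noteq> z"
      have Im: "Im w = - Im z" "Im z \<noteq> 0"
        using nrm Re ne by (auto simp: gauss_norm_def complex_eq_iff power2_eq_iff)
      \<comment> \<open>Then the midpoint \<open>Re z\<close> is a Gaussian integer on the line of smaller norm.\<close>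
      define u where "u = z + of_real (1/2) * (w - z)"
      have "u \<in> L"
        using gaussian_line_eq[OF L, of z w] Pz Pw ne unfolding u_def by blast
      moreover have u: "Re u = Re z" "Im u = 0" using Re Im by (simp_all add: u_def)
      moreover have "u \<in> gaussian_ints" using Pz u by (simp add: gaussian_ints_def)
      ultimately have "gauss_norm z \<le> gauss_norm u" using Pz by blast
      then show False using u Im by (simp add: gauss_norm_def)
    qed
  qed (rule Pz)
  then have "?P (alpha0 L)" unfolding alpha0_def by (rule theI')
  then show ?thesis by blast
qed

text \<open>Existence: off a vertical line, a second Gaussian integer has a different real part, and
  can be reflected to the right of \<open>alpha0 L\<close> if necessary; then the distance is
  minimised. Uniqueness: on the line only two points lie at a given positive distance from
  \<open>alpha0 L\<close>, one on each side.\<close>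

lemma alpha1_properties:
  assumes L: "gaussian_line L" and nv: "\<not> vertical L"
  shows "alpha1 L \<in> L \<inter> gaussian_ints" and "Re (alpha0 L) < Re (alpha1 L)"
    and "\<And>w. w \<in> L \<inter> gaussian_ints \<Longrightarrow> Re (alpha0 L) < Re w \<Longrightarrow>
      dist (alpha0 L) (alpha1 L) \<le> dist (alpha0 L) w"
proof -
  let ?S = "L \<inter> gaussian_ints"
  let ?a = "alpha0 L"
  let ?P = "\<lambda>z. z \<in> ?S \<and> Re ?a < Re z \<and>
     (\<forall>w\<in>?S. Re ?a < Re w \<longrightarrow> dist ?a z \<le> dist ?a w)"
  have a: "?a \<in> ?S" using alpha0_properties[OF L] .
  define T where "T = {w \<in> ?S. Re ?a < Re w}"
  obtain w where w: "w \<in> ?S" "w \<noteq> ?a" using L unfolding gaussian_line_def by metis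
  have Leq: "L = range (\<lambda>r. ?a + of_real r * (w - ?a))"
    using gaussian_line_eq[OF L] a w by blast
  have Rew: "Re w \<noteq> Re ?a"
  proof
    assume eq: "Re w = Re ?a"
    have "Re z = Re ?a" if "z \<in> L" for z
    proof -
      obtain r where "z = ?a + of_real r * (w - ?a)" using \<open>z \<in> L\<close> Leq by blast
      then show ?thesis using eq by simp
    qed
    then show False using nv by (simp add: vertical_def)
  qed
  have "\<exists>x. x \<in> T"
  proof (cases "Re ?a < Re w")
    case True
    then show ?thesis using w by (auto simp: T_def)
  next
    case False
    \<comment> \<open>The reflection of \<open>w\<close> in \<open>alpha0 L\<close>.\<close>
    let ?x = "?a + of_real (- 1) * (w - ?a)"
    have "?x \<in> L" using Leq by blast
    moreover have "?x \<in> gaussian_ints" using a w by (auto simp: gaussian_ints_def)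
    ultimately show ?thesis using False Rew by (intro exI[of _ ?x]) (simp add: T_def)
  qed
  then obtain x where "x \<in> T" ..
  then obtain z where z: "z \<in> T"
    "\<And>w. w \<in> T \<Longrightarrow> gauss_norm (z - ?a) \<le> gauss_norm (w - ?a)"
    using exists_min_gauss_norm[of x T "\<lambda>w. w - ?a"] a by (auto simp: T_def)
  have zle: "dist ?a z \<le> dist ?a u" if "u \<in> T" for u
    using z(2)[OF that] gauss_norm_less_iff[of "u - ?a" "z - ?a"]
    by (simp add: dist_norm norm_minus_commute)
  have Pz: "?P z" using z(1) zle by (auto simp: T_def)
  have "\<exists>!z. ?P z"
  proof (rule ex1I[of _ z])
    fix u assume Pu: "?P u"
    have d: "dist ?a u = dist ?a z" using Pu Pz by (metis order_antisym)
    obtain r s where r: "z = ?a + of_real r * (w - ?a)" and s: "u = ?a + of_real s * (w - ?a)"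
      using Pz Pu Leq by blast
    have "norm (z - ?a) = norm (u - ?a)" using d by (simp add: dist_norm norm_minus_commute)
    then have "\<bar>r\<bar> = \<bar>s\<bar>" using r s w(2) by (metis add_diff_cancel_left' norm_mult norm_of_real
      mult_right_cancel norm_eq_zero right_minus_eq)
    \<comment> \<open>Both points lie to the right of \<open>alpha0 L\<close>, so \<open>r\<close>
      and \<open>s\<close> have the sign of \<open>Re (w - ?a)\<close>; having equal absolute
      values, they coincide.\<close>
    moreover have "0 < r * Re (w - ?a)" "0 < s * Re (w - ?a)"
      using Pz Pu arg_cong[OF r, of Re] arg_cong[OF s, of Re] by simp_all
    then have "0 < r \<longleftrightarrow> 0 < s" by (auto simp: zero_less_mult_iff)
    ultimately have "r = s" by linarith
    then show "u = z" using r s by simp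
  qed (rule Pz)
  then have *: "?P (alpha1 L)" unfolding alpha1_def by (rule theI')
  then show "alpha1 L \<in> ?S" "Re ?a < Re (alpha1 L)" by blast+
  show "dist ?a (alpha1 L) \<le> dist ?a w" if "w \<in> ?S" "Re ?a < Re w" for w
    using * that by blast
qed

lemma delta_in_gaussian_ints:
  assumes "gaussian_line L"
  shows "delta L \<in> gaussian_ints" and "delta L \<noteq> 0"
  using alpha0_properties[OF assms] alpha1_properties[OF assms]
  by (auto simp: delta_def)

text \<open>On a vertical line the index is the difference of imaginary parts. Otherwise, a
  non-integral parameter would leave, after removal of its integer part, a Gaussian integer strictly
  between \<open>alpha0 L\<close> and \<open>alpha1 L\<close>, against the choice of
  \<open>alpha1 L\<close>. This lets primitivity of the line be read off from the
  \<open>alpha L n\<close>.\<close>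

lemma gaussian_line_subset_alpha:
  assumes L: "gaussian_line L" and p: "p \<in> L \<inter> gaussian_ints"
  obtains n where "p = alpha L n"
proof (cases "vertical L")
  case True
  have a: "alpha0 L \<in> L \<inter> gaussian_ints" using alpha0_properties[OF L] .
  then have Re: "Re p = Re (alpha0 L)" using True p by (auto simp: vertical_def)
  have "Im p - Im (alpha0 L) \<in> \<int>" using a p by (auto simp: gaussian_ints_def)
  then obtain n where "Im p - Im (alpha0 L) = of_int n" by (auto elim: Ints_cases)
  then have "p = alpha L n" using Re True
    by (simp add: alpha_def delta_def complex_eq_iff)
  then show thesis by (rule that)
next
  case False
  let ?a = "alpha0 L"
  have a: "?a \<in> L \<inter> gaussian_ints" using alpha0_properties[OF L] .
  note a1 = alpha1_properties[OF L False]
  have \<delta>: "delta L = alpha1 L - ?a" using False by (simp add: delta_def)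
  have ne: "?a \<noteq> alpha1 L" using a1(2) by auto
  have Leq: "L = range (\<lambda>r. ?a + of_real r * delta L)"
    using gaussian_line_eq[OF L _ _ ne] a a1(1) \<delta> by simp
  then obtain r where r: "p = ?a + of_real r * delta L" using p by blast
  define f where "f = r - of_int \<lfloor>r\<rfloor>"
  have f: "0 \<le> f" "f < 1" unfolding f_def by linarith+
  let ?w = "?a + of_real f * delta L"
  \<comment> \<open>Shifting \<open>p\<close> by an integer multiple of \<open>delta L\<close> keeps
    it Gaussian.\<close>
  have "?w = p - of_int \<lfloor>r\<rfloor> * delta L" by (simp add: r f_def algebra_simps)
  then have "?w \<in> gaussian_ints"
    using p delta_in_gaussian_ints[OF L] by auto
  then have w: "?w \<in> L \<inter> gaussian_ints" using Leq by blast
  have "f = 0"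
  proof (rule ccontr)
    assume "f \<noteq> 0"
    then have "Re ?a < Re ?w" using f a1(2) \<delta> by simp
    then have "dist ?a (alpha1 L) \<le> dist ?a ?w" using a1(3) w by blast
    moreover have "dist ?a (alpha1 L) = norm (delta L)"
      by (simp add: \<delta> dist_norm norm_minus_commute)
    moreover have "dist ?a ?w = f * norm (delta L)"
      using f by (simp add: dist_norm norm_mult)
    ultimately show False using f delta_in_gaussian_ints(2)[OF L] by simp
  qed
  then have "complex_of_real r = of_int \<lfloor>r\<rfloor>"
    unfolding f_def by (metis eq_iff_diff_eq_0 of_real_of_int_eq)
  then have "p = alpha L \<lfloor>r\<rfloor>" using r by (simp add: alpha_def mult.commute)
  then show thesis by (rule that)
qed

section \<open>Divisibility along a primitive line\<close>

lemma alpha_eq: "alpha L n = alpha L t + delta L * of_int (n - t)"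
  by (simp add: alpha_def algebra_simps)

theorem theorem3:
  fixes L :: "complex set" and \<beta> :: complex and t n :: int
  assumes "primitive_line L"
    and "\<beta> \<in> gaussian_ints"
    and "\<beta> gdvd alpha L t"
  shows "\<beta> gdvd alpha L n \<longleftrightarrow> [n = t] (mod nu \<beta>)"
proof -
  have L: "gaussian_line L" using assms(1) by (simp add: primitive_line_def)
  note \<delta> = delta_in_gaussian_ints[OF L]
  have "gauss_unit d" if d: "d gdvd \<beta>" "d gdvd delta L" for d
  proof -
    have "d gdvd z" if z: "z \<in> L \<inter> gaussian_ints" for z
    proof -
      obtain k where "z = alpha L k" using gaussian_line_subset_alpha[OF L z] .
      then show ?thesis
        unfolding alpha_eq[of L k t]
        using gdvd_add gdvd_mult gdvd_trans d assms(3) gaussian_ints_of_int by metis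
    qed
    moreover have "d \<in> gaussian_ints" using d(1) by (simp add: gauss_dvd_def)
    ultimately show ?thesis using assms(1) unfolding primitive_line_def by blast
  qed
  \<comment> \<open>\<open>delta L\<close> takes the second place in Bezout's identity because that
    argument must be nonzero, while \<open>\<beta>\<close> may be 0.\<close>
  then obtain x y where xy: "x \<in> gaussian_ints" "y \<in> gaussian_ints" "\<beta> * x + delta L * y = 1"
    using gaussian_bezout[OF assms(2) \<delta>] by blast
  let ?m = "of_int (n - t) :: complex"
  have "\<beta> gdvd alpha L n \<longleftrightarrow> \<beta> gdvd delta L * ?m"
    using alpha_eq[of L n t] assms(3) gdvd_add gdvd_diff by (metis add_diff_cancel_left')
  also have "\<dots> \<longleftrightarrow> \<beta> gdvd ?m"
  proof
    assume *: "\<beta> gdvd delta L * ?m"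
    have "\<beta> gdvd \<beta>" using assms(2) by (auto simp: gauss_dvd_def intro!: bexI[of _ 1])
    \<comment> \<open>Bezout's identity multiplied by \<open>?m\<close> writes \<open>?m\<close> as
      a sum of two multiples of \<open>\<beta>\<close>.\<close>
    then have "\<beta> gdvd \<beta> * (x * ?m) + delta L * ?m * y"
      using * xy by (intro gdvd_add gdvd_mult[of _ \<beta>] gdvd_mult[of _ "delta L * ?m"]) auto
    also have "\<beta> * (x * ?m) + delta L * ?m * y = (\<beta> * x + delta L * y) * ?m"
      by (simp add: algebra_simps)
    finally show "\<beta> gdvd ?m" by (simp add: xy(3))
  next
    assume "\<beta> gdvd ?m"
    then show "\<beta> gdvd delta L * ?m" using gdvd_mult \<delta>(1) by (metis mult.commute)
  qed
  also have "\<dots> \<longleftrightarrow> nu \<beta> dvd n - t" using gdvd_of_int_iff[OF assms(2)] .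
  also have "\<dots> \<longleftrightarrow> [n = t] (mod nu \<beta>)" by (simp add: cong_iff_dvd_diff)
  finally show ?thesis .
qed

end
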